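(* Let $M$ be a connected gridding matrix with exactly one corner and with dimensions $(r+1)\times(c+1)$. Then $$|\mathrm{Grid}^\#_n(M)|\sim\theta^\#g^n\quad(n\to\infty),\qquad\text{where}\quad\theta^\#=\frac{r+c+q+1}{2q}\quad\text{and}\quad g=\frac{r+c+q+1}{2},$$ with $q=\sqrt{(r+c+1)^2-4cr}$.
   Context: A permutation of length $n$ is identified with its plot $\{(i,\sigma_i)\}$. A gridding matrix $M$ is a matrix each of whose entries (cells) is "increasing", "decreasing" or "blank". If $M$ has $t$ columns (numbered left to right) and $u$ rows (numbered bottom to top), an $M$-gridding of a permutation $\sigma$ of length $n$ is a pair of integer sequences $0=c_0\leq\dots\leq c_t=n$ (column dividers) and $0=r_0\leq\dots\leq r_u=n$ (row dividers) such that for every column $i$ and row $j$ the subsequence of $\sigma$ with indices in $(c_{i-1},c_i]$ and values in $(r_{j-1},r_j]$ is increasing, decreasing or empty according to whether the entry of $M$ in column $i$, row $j$ is increasing, decreasing or blank. $\mathrm{Grid}^\#_n(M)$ is the set of $M$-gridded permutations of length $n$, i.e. pairs consisting of a permutation of length $n$ and one of its $M$-griddings. A corner of $M$ is a non-blank cell $C$ such that there is another non-blank cell in the row of $C$ and another non-blank cell in the column of $C$. A connected one-corner gridding matrix of dimensions $(r+1)\times(c+1)$ ($r+1$ rows and $c+1$ columns, $r,c\geq1$) has $r+c+1$ non-blank cells: a corner cell, $r$ other cells making up the rest of the column of the corner, and $c$ other cells making up the rest of the row of the corner; all other cells are blank. Here $f(n)\sim g(n)$ means $\lim_{n\to\infty}f(n)/g(n)=1$.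 *)

theory Defs
  imports
    Complex_Main
    "HOL-Combinatorics.Permutations"
    "HOL-Library.Landau_Symbols"
    "Jordan_Normal_Form.Matrix"
begin

datatype cell = Increasing | Decreasing | Blank

text \<open>
  The entry in row \<open>j\<close> and column \<open>i\<close> of a gridding matrix \<open>M\<close> is \<open>M $$ (j, i)\<close>. Indices start
  from 0, columns are counted from left to right, and rows from bottom to top as in the plot of a
  permutation (not from top to bottom as is usual for matrices).
\<close>

type_synonym gridding_matrix = "cell mat"

definition nonblank :: "gridding_matrix \<Rightarrow> nat \<times> nat \<Rightarrow> bool" where
  "nonblank M C \<longleftrightarrow> fst C < dim_row M \<and> snd C < dim_col M \<and> M $$ C \<noteq> Blank"

definition is_corner :: "gridding_matrix \<Rightarrow> nat \<times> nat \<Rightarrow> bool" where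
  "is_corner M C \<longleftrightarrow> nonblank M C
     \<and> (\<exists>D. nonblank M D \<and> D \<noteq> C \<and> fst D = fst C)
     \<and> (\<exists>D. nonblank M D \<and> D \<noteq> C \<and> snd D = snd C)"

text \<open>
  Connectedness of a gridding matrix is that of its row-column graph: the bipartite graph whose
  vertices are all the rows (\<open>Inl j\<close>) and all the columns (\<open>Inr i\<close>), and whose edges are the
  non-blank cells. In particular, a connected matrix with a non-blank cell has no row or column
  consisting of blank cells only.
\<close>

definition row_col_vertices :: "gridding_matrix \<Rightarrow> (nat + nat) set" where
  "row_col_vertices M = Inl ` {..<dim_row M} \<union> Inr ` {..<dim_col M}"

definition row_col_edges :: "gridding_matrix \<Rightarrow> ((nat + nat) \<times> (nat + nat)) set" where
  "row_col_edges M = {(Inl j, Inr i) | j i. nonblank M (j, i)}"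

definition connected_gridding_matrix :: "gridding_matrix \<Rightarrow> bool" where
  "connected_gridding_matrix M \<longleftrightarrow>
     (\<forall>v\<in>row_col_vertices M. \<forall>w\<in>row_col_vertices M.
        (v, w) \<in> (row_col_edges M \<union> (row_col_edges M)\<inverse>)\<^sup>*)"

definition is_divider_seq :: "nat \<Rightarrow> nat \<Rightarrow> nat list \<Rightarrow> bool" where
  "is_divider_seq n t ds \<longleftrightarrow> length ds = t + 1 \<and> sorted ds \<and> ds ! 0 = 0 \<and> ds ! t = n"

text \<open>
  The indices of the points of \<open>\<sigma>\<close> in the cell in row \<open>j\<close> and column \<open>i\<close>; since rows and columns are
  numbered from 0, column \<open>i\<close> lies between the dividers \<open>cs ! i\<close> and \<open>cs ! (i + 1)\<close>.
\<close>

definition cell_indices ::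
    "(nat \<Rightarrow> nat) \<Rightarrow> nat list \<Rightarrow> nat list \<Rightarrow> nat \<times> nat \<Rightarrow> nat set" where
  "cell_indices \<sigma> cs rs = (\<lambda>(j, i).
     {x \<in> {cs ! i<..cs ! (i + 1)}. \<sigma> x \<in> {rs ! j<..rs ! (j + 1)}})"

fun conforms :: "cell \<Rightarrow> (nat \<Rightarrow> nat) \<Rightarrow> nat set \<Rightarrow> bool" where
  "conforms Increasing \<sigma> X \<longleftrightarrow> strict_mono_on X \<sigma>"
| "conforms Decreasing \<sigma> X \<longleftrightarrow> strict_antimono_on X \<sigma>"
| "conforms Blank \<sigma> X \<longleftrightarrow> X = {}"

definition is_gridding ::
    "nat \<Rightarrow> gridding_matrix \<Rightarrow> (nat \<Rightarrow> nat) \<Rightarrow> nat list \<times> nat list \<Rightarrow> bool" where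
  "is_gridding n M \<sigma> = (\<lambda>(cs, rs).
     is_divider_seq n (dim_col M) cs \<and> is_divider_seq n (dim_row M) rs \<and>
     (\<forall>j<dim_row M. \<forall>i<dim_col M. conforms (M $$ (j, i)) \<sigma> (cell_indices \<sigma> cs rs (j, i))))"

definition gridded_perms ::
    "nat \<Rightarrow> gridding_matrix \<Rightarrow> ((nat \<Rightarrow> nat) \<times> (nat list \<times> nat list)) set" where
  "gridded_perms n M = {(\<sigma>, G). \<sigma> permutes {1..n} \<and> is_gridding n M \<sigma> G}"

end

theory Submission
  imports Defs "HOL-Library.Infinite_Set"
begin

text \<open>
  A gridded permutation is known once one knows, for each column, how the points of its cells
  interleave from left to right and, for each row, how the points of its cells interleave from
  bottom to top: a cell then has to match its points in the one order with its points in the other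
  order monotonically, which can be done in exactly one way. Conversely, any interleavings that agree
  on the number of points of every cell occur.

  A connected matrix with one corner is a cross: its non-blank cells are those in the row and in the
  column of the corner (\<open>one_corner_cross_shaped\<close>). All other rows and columns have one non-blank
  cell only, so just two interleavings carry information: that of the corner row, a word \<open>u\<close> over
  the columns, and that of the corner column, a word \<open>v\<close> over the rows. The only condition on them is
  that both have the same number of letters that stand for the corner
  (\<open>card_gridded_perms_cross_shaped\<close>). The corner points are counted in both words, so the length of
  the permutation is the total length of the words minus this number.

  Looking at the first letters shows how the number \<open>a n\<close> of these pairs grows. At least one of the
  following holds if \<open>n > 0\<close>: \<open>u\<close> starts with one of the \<open>c\<close> letters other than the corner, \<open>v\<close>
  starts with one of the \<open>r\<close> letters other than the corner, or both words start with the corner. The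
  last case excludes the first two, but these can occur together, and inclusion-exclusion gives
  \<open>a (n + 2) = (r + c + 1) * a (n + 1) - c * r * a n\<close> with \<open>a 0 = 1\<close> and \<open>a 1 = r + c + 1\<close>. The
  characteristic roots are \<open>g\<close> and \<open>h = (r + c + 1 - q) / 2\<close>, which differ by \<open>q\<close>, so that
  \<open>a n = (g ^ (n + 1) - h ^ (n + 1)) / q\<close>. Since \<open>0 \<le> h < g\<close>, this is asymptotically
  \<open>g / q * g ^ n\<close>, and \<open>g / q = \<theta>\<close>.
\<close>

section \<open>Connected matrices with one corner\<close>

definition cross_shaped :: "gridding_matrix \<Rightarrow> nat \<times> nat \<Rightarrow> bool" where
  "cross_shaped M C \<longleftrightarrow> fst C < dim_row M \<and> snd C < dim_col M \<and>
     (\<forall>j<dim_row M. \<forall>i<dim_col M. nonblank M (j, i) \<longleftrightarrow> j = fst C \<or> i = snd C)"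

text \<open>
  The hypothesis on \<open>S\<close> makes it a union of components of the row-column graph, so in a connected matrix
  \<open>S\<close> misses no row or column unless it misses all.
\<close>
lemma connected_closed_set:
  assumes conn: "connected_gridding_matrix M"
    and closed: "\<And>j i. nonblank M (j, i) \<Longrightarrow> Inl j \<in> S \<longleftrightarrow> Inr i \<in> S"
    and v: "v \<in> row_col_vertices M" "v \<in> S" and w: "w \<in> row_col_vertices M"
  shows "w \<in> S"
proof -
  have "(v, w) \<in> (row_col_edges M \<union> (row_col_edges M)\<inverse>)\<^sup>*"
    using conn v w by (auto simp: connected_gridding_matrix_def)
  then show ?thesis
  proof (induction rule: rtrancl_induct)
    case base
    then show ?case by (rule v(2))
  next
    case (step y z)
    then show ?case using closed by (auto simp: row_col_edges_def)
  qed
qed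

text \<open>
  A non-blank cell \<open>D\<close> outside the row and the column of the corner \<open>C\<close> is not a corner, so it is
  alone in its row, say. Then the other cells of its column are alone in their rows too, because they
  would be corners otherwise, and the column of \<open>D\<close> with the rows meeting it is a component that
  avoids the column of \<open>C\<close>. Hence all non-blank cells lie on the cross through \<open>C\<close>; no cell of the
  cross is blank, since otherwise a whole row or column would be blank and thus isolated.
\<close>
lemma one_corner_cross_shaped:
  assumes conn: "connected_gridding_matrix M"
    and C: "is_corner M C" and unique: "\<And>D. is_corner M D \<Longrightarrow> D = C"
  shows "cross_shaped M C"
proof -
  obtain j0 i0 where C_eq: "C = (j0, i0)" by (cases C)
  have bounds: "j0 < dim_row M" "i0 < dim_col M"
    using C by (auto simp: C_eq is_corner_def nonblank_def)
  have nbC: "nonblank M (j0, i0)"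
    using C by (simp add: C_eq is_corner_def)
  have corner_eq: "j = j0 \<and> i = i0"
    if "nonblank M (j, i)" "nonblank M (j, i')" "i' \<noteq> i" "nonblank M (j', i)" "j' \<noteq> j" for j i j' i'
  proof -
    have "is_corner M (j, i)"
      unfolding is_corner_def
      using that by (metis fst_conv snd_conv)
    then show ?thesis using unique[of "(j, i)"] by (simp add: C_eq)
  qed
  have on_cross: "j = j0 \<or> i = i0" if nb: "nonblank M (j, i)" for j i
  proof (rule ccontr)
    assume off: "\<not> (j = j0 \<or> i = i0)"
    have ij: "j < dim_row M" "i < dim_col M" using nb by (auto simp: nonblank_def)
    consider (row) "\<And>i'. nonblank M (j, i') \<Longrightarrow> i' = i" | (col) "\<And>j'. nonblank M (j', i) \<Longrightarrow> j' = j"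
      using corner_eq[OF nb] off by blast
    then show False
    proof cases
      case row
      \<comment> \<open>Column \<open>i\<close> and the rows that meet it, which no other column meets.\<close>
      define S where "S = insert (Inr i) {Inl j' | j'. nonblank M (j', i)}"
      have "Inr i0 \<in> S"
      proof (rule connected_closed_set[OF conn, where v = "Inr i"])
        show "Inl j' \<in> S \<longleftrightarrow> Inr i' \<in> S" if "nonblank M (j', i')" for j' i'
        proof (cases "i' = i")
          case False
          have "\<not> nonblank M (j', i)"
          proof
            assume j'i: "nonblank M (j', i)"
            have "j' \<noteq> j" using row that False by blast
            then show False using corner_eq[OF j'i that False nb] off by blast
          qed
          then show ?thesis using False by (auto simp: S_def)
        qed (use that in \<open>auto simp: S_def\<close>)
      qed (use bounds ij in \<open>auto simp: S_def row_col_vertices_def\<close>)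
      then show False using off by (auto simp: S_def)
    next
      case col
      define S where "S = insert (Inl j) {Inr i' | i'. nonblank M (j, i')}"
      have "Inl j0 \<in> S"
      proof (rule connected_closed_set[OF conn, where v = "Inl j"])
        show "Inl j' \<in> S \<longleftrightarrow> Inr i' \<in> S" if "nonblank M (j', i')" for j' i'
        proof (cases "j' = j")
          case False
          have "\<not> nonblank M (j, i')"
          proof
            assume ji': "nonblank M (j, i')"
            have "i' \<noteq> i" using col that False by blast
            then show False using corner_eq[OF ji' nb _ that False] off by blast
          qed
          then show ?thesis using False by (auto simp: S_def)
        qed (use that in \<open>auto simp: S_def\<close>)
      qed (use bounds ij in \<open>auto simp: S_def row_col_vertices_def\<close>)
      then show False using off by (auto simp: S_def)
    qed
  qed
  have row_full: "nonblank M (j0, i)" if i: "i < dim_col M" for i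
  proof (rule ccontr)
    assume blank: "\<not> nonblank M (j0, i)"
    then have "i \<noteq> i0" using nbC by blast
    have "Inl j0 \<in> {Inr i :: nat + nat}"
    proof (rule connected_closed_set[OF conn, where v = "Inr i"])
      show "Inl j' \<in> {Inr i} \<longleftrightarrow> Inr i' \<in> {Inr i}" if "nonblank M (j', i')" for j' i'
        using on_cross[OF that] that blank \<open>i \<noteq> i0\<close> by auto
    qed (use bounds i in \<open>auto simp: row_col_vertices_def\<close>)
    then show False by simp
  qed
  have col_full: "nonblank M (j, i0)" if j: "j < dim_row M" for j
  proof (rule ccontr)
    assume blank: "\<not> nonblank M (j, i0)"
    then have "j \<noteq> j0" using nbC by blast
    have "Inr i0 \<in> {Inl j :: nat + nat}"
    proof (rule connected_closed_set[OF conn, where v = "Inl j"])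
      show "Inl j' \<in> {Inl j} \<longleftrightarrow> Inr i' \<in> {Inl j}" if "nonblank M (j', i')" for j' i'
        using on_cross[OF that] that blank \<open>j \<noteq> j0\<close> by auto
    qed (use bounds j in \<open>auto simp: row_col_vertices_def\<close>)
    then show False by simp
  qed
  show ?thesis
    unfolding cross_shaped_def C_eq fst_conv snd_conv
    using bounds on_cross row_full col_full by blast
qed

section \<open>Counting pairs of words with equally many special letters\<close>

text \<open>
  The letters \<open>a\<close> and \<open>b\<close> stand for the same objects, which are counted once in \<open>n\<close> although they
  appear in both words. Up to this identification the pairs are the elements of length \<open>n\<close> of the
  partially commutative monoid generated by \<open>a = b\<close> and the other letters of \<open>A\<close> and of \<open>B\<close>, in
  which the latter two kinds of letters commute with each other.
\<close>
definition word_pairs :: "'a set \<Rightarrow> 'b set \<Rightarrow> 'a \<Rightarrow> 'b \<Rightarrow> nat \<Rightarrow> ('a list \<times> 'b list) set" where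
  "word_pairs A B a b n = {(u, v). set u \<subseteq> A \<and> set v \<subseteq> B \<and>
     count_list u a = count_list v b \<and> length u + length v = n + count_list u a}"

lemma finite_word_pairs:
  assumes "finite A" "finite B"
  shows "finite (word_pairs A B a b n)"
proof (rule finite_subset)
  have "length u \<le> n \<and> length v \<le> n" if "(u, v) \<in> word_pairs A B a b n" for u v
    using that count_le_length[of u a] count_le_length[of v b] by (auto simp: word_pairs_def)
  then show "word_pairs A B a b n \<subseteq>
      {u. set u \<subseteq> A \<and> length u \<le> n} \<times> {v. set v \<subseteq> B \<and> length v \<le> n}"
    by (auto simp: word_pairs_def)
qed (use assms in \<open>simp add: finite_lists_length_le\<close>)

lemma word_pairs_0: "word_pairs A B a b 0 = {([], [])}"
proof -
  have "u = [] \<and> v = []" if "(u, v) \<in> word_pairs A B a b 0" for u v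
  proof -
    have uv: "count_list u a = count_list v b" "length u + length v = count_list u a"
      using that by (auto simp: word_pairs_def)
    then have "length u = 0 \<and> length v = 0"
      using count_le_length[of u a] count_le_length[of v b] by linarith
    then show ?thesis by simp
  qed
  then show ?thesis by (auto simp: word_pairs_def)
qed

definition cons_left :: "'a set \<Rightarrow> ('a list \<times> 'b list) set \<Rightarrow> ('a list \<times> 'b list) set" where
  "cons_left A W = (\<lambda>(x, u, v). (x # u, v)) ` (A \<times> W)"

definition cons_right :: "'b set \<Rightarrow> ('a list \<times> 'b list) set \<Rightarrow> ('a list \<times> 'b list) set" where
  "cons_right B W = (\<lambda>(y, u, v). (u, y # v)) ` (B \<times> W)"

lemma card_cons_left: "card (cons_left A W) = card A * card W"
  unfolding cons_left_def by (subst card_image) (auto simp: inj_on_def card_cartesian_product)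

lemma card_cons_right: "card (cons_right B W) = card B * card W"
  unfolding cons_right_def by (subst card_image) (auto simp: inj_on_def card_cartesian_product)

lemma cons_left_iff: "(u, v) \<in> cons_left A W \<longleftrightarrow> (\<exists>x u'. u = x # u' \<and> x \<in> A \<and> (u', v) \<in> W)"
  by (force simp: cons_left_def)

lemma cons_right_iff: "(u, v) \<in> cons_right B W \<longleftrightarrow> (\<exists>y v'. v = y # v' \<and> y \<in> B \<and> (u, v') \<in> W)"
  by (force simp: cons_right_def)

lemma word_pairs_Cons_left:
  "x \<noteq> a \<Longrightarrow> (x # u, v) \<in> word_pairs A B a b (Suc n) \<longleftrightarrow> x \<in> A \<and> (u, v) \<in> word_pairs A B a b n"
  by (auto simp: word_pairs_def)

lemma word_pairs_Cons_right:
  "y \<noteq> b \<Longrightarrow> (u, y # v) \<in> word_pairs A B a b (Suc n) \<longleftrightarrow> y \<in> B \<and> (u, v) \<in> word_pairs A B a b n"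
  by (auto simp: word_pairs_def)

lemma word_pairs_Cons_both:
  "(a # u, b # v) \<in> word_pairs A B a b (Suc n) \<longleftrightarrow> a \<in> A \<and> b \<in> B \<and> (u, v) \<in> word_pairs A B a b n"
  by (auto simp: word_pairs_def)

text \<open>
  The cases are exhaustive because the two words have equally many special letters: if one starts with
  its special letter, then the other is not empty.
\<close>
lemma word_pairs_first_letters:
  assumes ab: "a \<in> A" "b \<in> B"
  shows "word_pairs A B a b (Suc n) =
    cons_left (A - {a}) (word_pairs A B a b n) \<union> cons_right (B - {b}) (word_pairs A B a b n) \<union>
    cons_left {a} (cons_right {b} (word_pairs A B a b n))" (is "_ = ?L \<union> ?R \<union> ?C")
proof -
  have "(u, v) \<in> word_pairs A B a b (Suc n) \<longleftrightarrow> (u, v) \<in> ?L \<union> ?R \<union> ?C" for u v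
  proof
    assume uv: "(u, v) \<in> word_pairs A B a b (Suc n)"
    show "(u, v) \<in> ?L \<union> ?R \<union> ?C"
    proof (cases "\<exists>x u'. u = x # u' \<and> x \<noteq> a")
      case True
      then show ?thesis using uv by (auto simp: cons_left_iff word_pairs_Cons_left)
    next
      case left: False
      show ?thesis
      proof (cases "\<exists>y v'. v = y # v' \<and> y \<noteq> b")
        case True
        then show ?thesis using uv by (auto simp: cons_right_iff word_pairs_Cons_right)
      next
        case False
        with left uv obtain u' v' where "u = a # u'" "v = b # v'"
          by (cases u; cases v) (auto simp: word_pairs_def)
        then show ?thesis
          using uv by (simp add: cons_left_iff cons_right_iff word_pairs_Cons_both)
      qed
    qed
  next
    assume "(u, v) \<in> ?L \<union> ?R \<union> ?C"
    then show "(u, v) \<in> word_pairs A B a b (Suc n)"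
      using ab by (auto simp: cons_left_iff cons_right_iff word_pairs_Cons_left
          word_pairs_Cons_right word_pairs_Cons_both)
  qed
  then show ?thesis by auto
qed

text \<open>
  Inclusion-exclusion over the three cases for the first letters: of these, only the first two overlap.
\<close>
lemma card_word_pairs_Suc:
  assumes fin: "finite A" "finite B" and ab: "a \<in> A" "b \<in> B"
  shows "card (word_pairs A B a b (Suc n)) +
      card (cons_left (A - {a}) (word_pairs A B a b n) \<inter> cons_right (B - {b}) (word_pairs A B a b n))
    = ((card A - 1) + (card B - 1) + 1) * card (word_pairs A B a b n)"
proof -
  let ?W = "word_pairs A B a b n"
  let ?L = "cons_left (A - {a}) ?W" and ?R = "cons_right (B - {b}) ?W"
    and ?C = "cons_left {a} (cons_right {b} ?W)"
  have finW: "finite ?W" using fin by (rule finite_word_pairs)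
  have finite: "finite ?L" "finite ?R" "finite ?C"
    using finW fin by (auto simp: cons_left_def cons_right_def)
  have "card (word_pairs A B a b (Suc n)) = card (?L \<union> ?R) + card ?C"
    unfolding word_pairs_first_letters[OF ab]
    by (rule card_Un_disjoint) (use finite in \<open>auto simp: cons_left_iff cons_right_iff\<close>)
  moreover have "card (?L \<union> ?R) + card (?L \<inter> ?R) = card ?L + card ?R"
    using card_Un_Int[OF finite(1,2)] by simp
  ultimately show ?thesis
    using ab fin by (simp add: card_cons_left card_cons_right algebra_simps)
qed

text \<open>
  There is no overlap here: a pair in which both words start with an ordinary letter has size at least 2.
\<close>
lemma card_word_pairs_1:
  assumes "finite A" "finite B" "a \<in> A" "b \<in> B"
  shows "card (word_pairs A B a b 1) = (card A - 1) + (card B - 1) + 1"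
proof -
  have "cons_left (A - {a}) {([], [])} \<inter> cons_right (B - {b}) {([], [])} = {}"
    by (auto simp: cons_left_iff cons_right_iff)
  then show ?thesis
    using card_word_pairs_Suc[OF assms, of 0] by (simp add: word_pairs_0)
qed

lemma card_word_pairs_Suc_Suc:
  assumes "finite A" "finite B" "a \<in> A" "b \<in> B"
  shows "card (word_pairs A B a b (Suc (Suc n))) + (card A - 1) * (card B - 1) * card (word_pairs A B a b n)
    = ((card A - 1) + (card B - 1) + 1) * card (word_pairs A B a b (Suc n))"
proof -
  have "cons_left (A - {a}) (word_pairs A B a b (Suc n)) \<inter> cons_right (B - {b}) (word_pairs A B a b (Suc n))
    = cons_left (A - {a}) (cons_right (B - {b}) (word_pairs A B a b n))"
    by (auto simp: cons_left_iff cons_right_iff word_pairs_Cons_left word_pairs_Cons_right)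
  then show ?thesis
    using card_word_pairs_Suc[OF assms, of "Suc n"] assms
    by (simp add: card_cons_left card_cons_right)
qed

section \<open>Permutations assembled from monotone pieces\<close>

text \<open>
  The prefix \<open>inv\<close> would be ambiguous, being also that of the inverse in a group.
\<close>
abbreviation perm_inv :: "('a \<Rightarrow> 'a) \<Rightarrow> 'a \<Rightarrow> 'a" where
  "perm_inv \<equiv> inv_into UNIV"

text \<open>
  Both sets are enumerated increasingly by the same initial segment of the natural numbers.
\<close>
lemma strict_mono_bij_exists:
  fixes X Y :: "nat set"
  assumes "finite X" "finite Y" "card X = card Y"
  obtains f where "bij_betw f X Y" "strict_mono_on X f"
proof -
  obtain h where h: "bij_betw h {..<card X} X" "strict_mono_on {..<card X} h"
    using ex_bij_betw_strict_mono_card[OF assms(1)] .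
  obtain k where k: "bij_betw k {..<card X} Y" "strict_mono_on {..<card X} k"
    using ex_bij_betw_strict_mono_card[OF assms(2)] assms(3) by metis
  let ?h' = "inv_into {..<card X} h"
  have h': "bij_betw ?h' X {..<card X}"
    using h(1) by (rule bij_betw_inv_into)
  have "k (?h' x) < k (?h' y)" if "x \<in> X" "y \<in> X" "x < y" for x y
  proof -
    have mem: "?h' x \<in> {..<card X}" "?h' y \<in> {..<card X}"
      using h' that by (auto simp: bij_betw_def)
    have "h (?h' x) < h (?h' y)"
      using bij_betw_inv_into_right[OF h(1)] that by simp
    then have "?h' x < ?h' y"
      using strict_mono_on_less[OF h(2) mem] by simp
    then show ?thesis
      using strict_mono_onD[OF k(2) mem] by simp
  qed
  then have "strict_mono_on X (k \<circ> ?h')"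
    by (auto intro!: strict_mono_onI)
  then show ?thesis
    using that bij_betw_trans[OF h' k(1)] by blast
qed

lemma conforming_bij_exists:
  fixes X Y :: "nat set"
  assumes fin: "finite X" "finite Y" and card: "card X = card Y"
    and blank: "e = Blank \<Longrightarrow> X = {}"
  obtains f where "bij_betw f X Y" "conforms e f X"
proof (cases e)
  case Increasing
  then show ?thesis using strict_mono_bij_exists[OF fin card] that by auto
next
  case Blank
  then have "X = {}" "Y = {}" using blank card fin by auto
  then show ?thesis using that[of id] Blank by simp
next
  case Decreasing
  obtain N where N: "\<And>y. y \<in> Y \<Longrightarrow> y \<le> N"
    using fin(2) by (meson finite_nat_set_iff_bounded_le)
  \<comment> \<open>Reflecting the values turns a decreasing bijection into an increasing one.\<close>
  let ?flip = "\<lambda>y. N - y"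
  have flip: "bij_betw ?flip Y (?flip ` Y)"
    by (rule inj_on_imp_bij_betw) (auto simp: inj_on_def dest!: N)
  have flip': "bij_betw ?flip (?flip ` Y) Y"
    by (rule bij_betw_byWitness[where f' = ?flip]) (auto simp: N)
  have "card X = card (?flip ` Y)"
    using card bij_betw_same_card[OF flip] by simp
  then obtain f where f: "bij_betw f X (?flip ` Y)" "strict_mono_on X f"
    using strict_mono_bij_exists[OF fin(1)] fin(2) by blast
  have "strict_antimono_on X (?flip \<circ> f)"
  proof (rule monotone_onI)
    fix x y assume xy: "x \<in> X" "y \<in> X" "x < y"
    have "f x < f y" using strict_mono_onD[OF f(2) xy] .
    moreover have "f y \<in> ?flip ` Y" using f(1) xy by (auto simp: bij_betw_def)
    ultimately show "(?flip \<circ> f) x > (?flip \<circ> f) y"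
      by auto
  qed
  then show ?thesis
    using that[OF bij_betw_trans[OF f(1) flip']] Decreasing by simp
qed

lemma conforms_inj_on:
  assumes "conforms e f X"
  shows "inj_on f X"
proof (rule linorder_inj_onI)
  show "f x \<noteq> f y" if "x < y" "x \<in> X" "y \<in> X" for x y
    using assms that by (cases e) (auto dest: monotone_onD)
qed auto

text \<open>
  At the least point where \<open>f\<close> and \<open>f'\<close> differ, each value is taken by the other function too and,
  by injectivity, not at an earlier point. For increasing functions this says that each of the two values
  is at least the other one; for decreasing functions it says that each is at most the other one.
\<close>
lemma conforming_unique:
  assumes "conforms e f X" "conforms e f' X" and image: "f ` X = f' ` X" and "x \<in> X"
  shows "f x = f' x"
  using \<open>x \<in> X\<close>
proof (induction x rule: less_induct)
  case (less x)
  have inj: "inj_on f X" "inj_on f' X"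
    using assms(1,2) by (auto intro: conforms_inj_on)
  obtain y where y: "y \<in> X" "f' x = f y" using image less.prems by (metis imageE imageI)
  obtain z where z: "z \<in> X" "f x = f' z" using image less.prems by (metis imageE imageI)
  show ?case
  proof (cases "y < x \<or> z < x")
    case True
    then show ?thesis
      using less.IH[of y] less.IH[of z] y z inj less.prems by (metis inj_onD)
  next
    case False
    then have le: "x \<le> y" "x \<le> z" by auto
    show ?thesis
    proof (cases e)
      case Increasing
      then have "f x \<le> f y" "f' x \<le> f' z"
        using assms(1,2) le less.prems y(1) z(1)
        by (metis conforms.simps(1) strict_mono_on_leD)+
      then show ?thesis using y z by simp
    next
      case Decreasing
      then have "f y \<le> f x" "f' z \<le> f' x"
        using assms(1,2) le less.prems y(1) z(1)
        by (auto simp: monotone_on_def le_less)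
      then show ?thesis using y z by simp
    next
      case Blank
      then show ?thesis using assms(1) less.prems by simp
    qed
  qed
qed

lemma conforms_cong: "(\<And>x. x \<in> X \<Longrightarrow> f x = f' x) \<Longrightarrow> conforms e f X \<longleftrightarrow> conforms e f' X"
  by (cases e) (simp_all add: monotone_on_def)

text \<open>
  The maps \<open>p\<close> and \<open>q\<close> label the indices and the values. For griddings, a label is a cell: \<open>p\<close> says
  in which cell the point with a given index is to be, and \<open>q\<close> does the same for a given value. If the
  two prescriptions give each cell equally many points, then the cells can be filled separately.
\<close>
lemma piecewise_conforming_permutation_exists:
  fixes p q :: "nat \<Rightarrow> 'k" and e :: "'k \<Rightarrow> cell"
  assumes fin: "finite A"
    and card: "\<And>k. k \<in> I \<Longrightarrow> card {x \<in> A. p x = k} = card {y \<in> A. q y = k}"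
    and blank: "\<And>k. k \<in> I \<Longrightarrow> e k = Blank \<Longrightarrow> {x \<in> A. p x = k} = {}"
    and range: "p ` A \<subseteq> I"
  shows "\<exists>\<sigma>. \<sigma> permutes A \<and> (\<forall>x\<in>A. q (\<sigma> x) = p x) \<and>
    (\<forall>k\<in>I. conforms (e k) \<sigma> {x \<in> A. p x = k})"
proof -
  have "\<forall>k\<in>I. \<exists>f. bij_betw f {x \<in> A. p x = k} {y \<in> A. q y = k} \<and>
      conforms (e k) f {x \<in> A. p x = k}"
  proof
    fix k assume k: "k \<in> I"
    have fins: "finite {x \<in> A. p x = k}" "finite {y \<in> A. q y = k}"
      by (rule finite_subset[OF _ fin], blast)+
    obtain f where "bij_betw f {x \<in> A. p x = k} {y \<in> A. q y = k}" "conforms (e k) f {x \<in> A. p x = k}"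
      by (rule conforming_bij_exists[OF fins card[OF k], where e = "e k"]) (erule blank[OF k])
    then show "\<exists>f. bij_betw f {x \<in> A. p x = k} {y \<in> A. q y = k} \<and> conforms (e k) f {x \<in> A. p x = k}"
      by blast
  qed
  from bchoice[OF this] obtain f where bij: "\<And>k. k \<in> I \<Longrightarrow> bij_betw (f k) {x \<in> A. p x = k} {y \<in> A. q y = k}"
    and conf: "\<And>k. k \<in> I \<Longrightarrow> conforms (e k) (f k) {x \<in> A. p x = k}"
    by blast
  define \<sigma> where "\<sigma> x = (if x \<in> A then f (p x) x else x)" for x
  have mem: "\<sigma> x \<in> A" "q (\<sigma> x) = p x" if "x \<in> A" for x
    using bij_betwE[OF bij[of "p x"]] that range by (auto simp: \<sigma>_def)
  have "inj_on \<sigma> A"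
  proof (rule inj_onI)
    fix x y assume xy: "x \<in> A" "y \<in> A" "\<sigma> x = \<sigma> y"
    then have "p x = p y" using mem(2) by metis
    then show "x = y"
      using bij_betw_imp_inj_on[OF bij[of "p x"]] xy range by (auto simp: \<sigma>_def inj_on_def)
  qed
  then have "\<sigma> permutes A"
    by (rule inj_imp_permutes) (use fin mem(1) in \<open>auto simp: \<sigma>_def\<close>)
  moreover have "conforms (e k) \<sigma> {x \<in> A. p x = k}" if "k \<in> I" for k
    using conf[OF that] by (subst conforms_cong[where f' = "f k"]) (auto simp: \<sigma>_def)
  ultimately show ?thesis using mem(2) by blast
qed

section \<open>Dividers\<close>

text \<open>
  The number of the row or column that contains the value or index \<open>x\<close>. Stripes may be empty, so
  several dividers can coincide; the least \<open>i\<close> is the one whose stripe has \<open>x\<close> in it.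
\<close>
definition stripe :: "nat list \<Rightarrow> nat \<Rightarrow> nat" where
  "stripe ds x = (LEAST i. x \<le> ds ! (i + 1))"

lemma divider_seq_mono:
  "is_divider_seq n t ds \<Longrightarrow> i \<le> k \<Longrightarrow> k \<le> t \<Longrightarrow> ds ! i \<le> ds ! k"
  by (auto simp: is_divider_seq_def intro!: sorted_nth_mono)

lemma divider_seq_le:
  "is_divider_seq n t ds \<Longrightarrow> k \<le> t \<Longrightarrow> ds ! k \<le> n"
  using divider_seq_mono[of n t ds k t] by (simp add: is_divider_seq_def)

lemma stripe_eq:
  assumes "is_divider_seq n t ds" "i < t" "ds ! i < x" "x \<le> ds ! (i + 1)"
  shows "stripe ds x = i"
  unfolding stripe_def
proof (rule Least_equality)
  fix k assume k: "x \<le> ds ! (k + 1)"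
  show "i \<le> k"
  proof (rule ccontr)
    assume "\<not> i \<le> k"
    then have "ds ! (k + 1) \<le> ds ! i" using divider_seq_mono[OF assms(1)] assms(2) by simp
    then show False using k assms(3) by simp
  qed
qed (rule assms)

lemma stripe_bounds:
  assumes ds: "is_divider_seq n t ds" and x: "x \<in> {1..n}"
  shows "stripe ds x < t" "ds ! stripe ds x < x" "x \<le> ds ! (stripe ds x + 1)"
proof -
  have "t \<noteq> 0" using ds x by (intro notI) (auto simp: is_divider_seq_def)
  then obtain s where s: "t = Suc s" using not0_implies_Suc by blast
  have ex: "x \<le> ds ! (s + 1)" using ds x s by (simp add: is_divider_seq_def)
  show "stripe ds x < t"
    unfolding stripe_def s less_Suc_eq_le by (rule Least_le, rule ex)
  show "x \<le> ds ! (stripe ds x + 1)"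
    unfolding stripe_def by (rule LeastI, rule ex)
  show "ds ! stripe ds x < x"
  proof (cases "stripe ds x")
    case 0
    then show ?thesis using ds x by (simp add: is_divider_seq_def)
  next
    case (Suc m)
    then have "\<not> x \<le> ds ! (m + 1)"
      unfolding stripe_def using not_less_Least by (metis lessI)
    then show ?thesis using Suc by simp
  qed
qed

lemma stripe_set:
  assumes ds: "is_divider_seq n t ds" and i: "i < t"
  shows "{ds ! i<..ds ! (i + 1)} = {x \<in> {1..n}. stripe ds x = i}"
proof (intro Set.set_eqI iffI)
  fix x assume x: "x \<in> {ds ! i<..ds ! (i + 1)}"
  then have "x \<in> {1..n}" using divider_seq_le[OF ds, of "i + 1"] i by auto
  then show "x \<in> {x \<in> {1..n}. stripe ds x = i}" using stripe_eq[OF ds i] x by simp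
next
  fix x assume "x \<in> {x \<in> {1..n}. stripe ds x = i}"
  then show "x \<in> {ds ! i<..ds ! (i + 1)}" using stripe_bounds[OF ds, of x] by auto
qed

lemma card_stripe:
  assumes "is_divider_seq n t ds" "i < t"
  shows "card {x \<in> {1..n}. stripe ds x = i} = ds ! (i + 1) - ds ! i"
  unfolding stripe_set[OF assms, symmetric] by simp

lemma divider_seq_eqI:
  assumes ds: "is_divider_seq n t ds" "is_divider_seq n' t ds'"
    and widths: "\<And>i. i < t \<Longrightarrow> ds ! (i + 1) - ds ! i = ds' ! (i + 1) - ds' ! i"
  shows "ds = ds'"
proof (rule nth_equalityI)
  show "length ds = length ds'" using ds by (simp add: is_divider_seq_def)
  have "k \<le> t \<Longrightarrow> ds ! k = ds' ! k" for k
  proof (induction k)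
    case 0
    then show ?case using ds by (simp add: is_divider_seq_def)
  next
    case (Suc k)
    then show ?case
      using widths[of k] divider_seq_mono[OF ds(1), of k "k + 1"] divider_seq_mono[OF ds(2), of k "k + 1"]
      by simp
  qed
  then show "ds ! k = ds' ! k" if "k < length ds" for k
    using that ds by (simp add: is_divider_seq_def)
qed

lemma divider_seq_with_widths:
  fixes w :: "nat \<Rightarrow> nat"
  assumes "sum w {..<t} = n"
  obtains ds where "is_divider_seq n t ds" "\<And>i. i < t \<Longrightarrow> ds ! (i + 1) = ds ! i + w i"
proof
  let ?ds = "map (\<lambda>k. sum w {..<k}) [0..<t + 1]"
  have nth: "?ds ! k = sum w {..<k}" if "k \<le> t" for k
    using that by (simp del: upt_Suc)
  have "sorted ?ds"
    by (auto simp del: upt_Suc simp: sorted_iff_nth_mono intro!: sum_mono2)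
  then show "is_divider_seq n t ?ds"
    unfolding is_divider_seq_def using nth[of 0] nth[of t] assms by (simp del: upt_Suc)
  show "?ds ! (i + 1) = ?ds ! i + w i" if "i < t" for i
    using that nth[of i] nth[of "i + 1"] by (simp del: upt_Suc)
qed

section \<open>The words of a row and of a column\<close>

text \<open>
  The column word of column \<open>i\<close> is \<open>stripe_word \<sigma> cs rs i\<close>: it lists, from left to right, the rows of
  the points in that column. As inverting a permutation reflects its plot in the diagonal, the row word
  of row \<open>j\<close>, which lists the columns of its points from bottom to top, is
  \<open>stripe_word (perm_inv \<sigma>) rs cs j\<close>.
\<close>
definition stripe_word :: "(nat \<Rightarrow> nat) \<Rightarrow> nat list \<Rightarrow> nat list \<Rightarrow> nat \<Rightarrow> nat list" where
  "stripe_word f ds es i = map (\<lambda>x. stripe es (f x)) [ds ! i + 1..<ds ! (i + 1) + 1]"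

lemma count_list_map_distinct:
  "distinct xs \<Longrightarrow> count_list (map f xs) z = card {x \<in> set xs. f x = z}"
  by (simp add: count_list_eq_length_filter filter_map comp_def distinct_length_filter)
    (auto intro: arg_cong[where f = card])

lemma set_upt_stripe: "set [a + 1..<b + 1] = {a<..b}" for a b :: nat
  by auto

lemma count_stripe_word:
  assumes "is_divider_seq n t ds" "i < t"
  shows "count_list (stripe_word f ds es i) j = card {x \<in> {1..n}. stripe ds x = i \<and> stripe es (f x) = j}"
proof -
  have "count_list (stripe_word f ds es i) j = card {x \<in> {ds ! i<..ds ! (i + 1)}. stripe es (f x) = j}"
    unfolding stripe_word_def by (subst count_list_map_distinct) (simp_all only: distinct_upt set_upt_stripe)
  also have "{x \<in> {ds ! i<..ds ! (i + 1)}. stripe es (f x) = j} =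
      {x \<in> {1..n}. stripe ds x = i \<and> stripe es (f x) = j}"
    unfolding stripe_set[OF assms] by auto
  finally show ?thesis .
qed

lemma length_stripe_word: "length (stripe_word f ds es i) = ds ! (i + 1) - ds ! i"
  by (simp add: stripe_word_def del: upt_Suc)

text \<open>
  All that the counting of points uses of a gridding of a cross. Unlike the gridding itself, which
  refers to a matrix, this is literally symmetric under inversion of the permutation, so that every
  fact about columns yields its counterpart for rows.
\<close>
definition cross_supported ::
    "nat \<Rightarrow> nat \<Rightarrow> nat \<Rightarrow> nat \<Rightarrow> nat \<Rightarrow> (nat \<Rightarrow> nat) \<Rightarrow> nat list \<Rightarrow> nat list \<Rightarrow> bool" where
  "cross_supported n s t j0 i0 \<sigma> cs rs \<longleftrightarrow>
     \<sigma> permutes {1..n} \<and> is_divider_seq n t cs \<and> is_divider_seq n s rs \<and> i0 < t \<and> j0 < s \<and>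
     (\<forall>x\<in>{1..n}. stripe cs x = i0 \<or> stripe rs (\<sigma> x) = j0)"

lemma cross_supported_inv:
  assumes "cross_supported n s t j0 i0 \<sigma> cs rs"
  shows "cross_supported n t s i0 j0 (perm_inv \<sigma>) rs cs"
proof -
  have \<sigma>: "\<sigma> permutes {1..n}" using assms by (simp add: cross_supported_def)
  have "stripe rs y = j0 \<or> stripe cs (perm_inv \<sigma> y) = i0" if "y \<in> {1..n}" for y
  proof -
    have "perm_inv \<sigma> y \<in> {1..n}" using permutes_in_image[OF permutes_inv[OF \<sigma>]] that by blast
    then show ?thesis
      using assms permutes_inverses(1)[OF \<sigma>, of y] unfolding cross_supported_def by metis
  qed
  then show ?thesis
    using assms permutes_inv[OF \<sigma>] by (auto simp: cross_supported_def)
qed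

lemma permutes_bij_betw_Collect:
  assumes "\<sigma> permutes S"
  shows "bij_betw \<sigma> {x \<in> S. P x (\<sigma> x)} {y \<in> S. P (perm_inv \<sigma> y) y}"
  unfolding bij_betw_def
proof (intro conjI Set.set_eqI iffI)
  show "inj_on \<sigma> {x \<in> S. P x (\<sigma> x)}" using assms by (rule permutes_inj_on)
  fix y
  show "y \<in> {y \<in> S. P (perm_inv \<sigma> y) y}" if "y \<in> \<sigma> ` {x \<in> S. P x (\<sigma> x)}"
    using that permutes_in_image[OF assms] permutes_inverses(2)[OF assms] by auto
  show "y \<in> \<sigma> ` {x \<in> S. P x (\<sigma> x)}" if "y \<in> {y \<in> S. P (perm_inv \<sigma> y) y}"
    by (rule image_eqI[of _ _ "perm_inv \<sigma> y"])
      (use that permutes_in_image[OF permutes_inv[OF assms]] permutes_inverses(1)[OF assms] in auto)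
qed

lemma count_inverse_stripe_word:
  assumes "cross_supported n s t j0 i0 \<sigma> cs rs"
  shows "count_list (stripe_word (perm_inv \<sigma>) rs cs j0) i
    = card {x \<in> {1..n}. stripe cs x = i \<and> stripe rs (\<sigma> x) = j0}"
proof -
  have \<sigma>: "\<sigma> permutes {1..n}" and rs: "is_divider_seq n s rs" "j0 < s"
    using assms by (simp_all add: cross_supported_def)
  have "bij_betw \<sigma> {x \<in> {1..n}. stripe cs x = i \<and> stripe rs (\<sigma> x) = j0}
      {y \<in> {1..n}. stripe cs (perm_inv \<sigma> y) = i \<and> stripe rs y = j0}"
    by (rule permutes_bij_betw_Collect[OF \<sigma>, where P = "\<lambda>x y. stripe cs x = i \<and> stripe rs y = j0"])
  then show ?thesis
    unfolding count_stripe_word[OF rs] conj_commute[of "stripe rs _ = j0"]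
    by (rule bij_betw_same_card[symmetric])
qed

text \<open>
  Away from the corner column, all points of a column lie in the corner row and therefore contribute
  their letters to the row word.
\<close>
lemma stripe_width_from_words:
  assumes cross: "cross_supported n s t j0 i0 \<sigma> cs rs" and i: "i < t"
  shows "cs ! (i + 1) - cs ! i = (if i = i0 then length (stripe_word \<sigma> cs rs i0)
    else count_list (stripe_word (perm_inv \<sigma>) rs cs j0) i)"
proof (cases "i = i0")
  case True
  then show ?thesis by (simp add: length_stripe_word)
next
  case False
  have cs: "is_divider_seq n t cs" using cross by (simp add: cross_supported_def)
  have "cs ! (i + 1) - cs ! i = card {x \<in> {1..n}. stripe cs x = i}"
    by (rule card_stripe[OF cs i, symmetric])
  also have "{x \<in> {1..n}. stripe cs x = i} = {x \<in> {1..n}. stripe cs x = i \<and> stripe rs (\<sigma> x) = j0}"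
    using cross False by (auto simp: cross_supported_def)
  also have "card \<dots> = count_list (stripe_word (perm_inv \<sigma>) rs cs j0) i"
    by (rule count_inverse_stripe_word[OF cross, symmetric])
  finally show ?thesis using False by simp
qed

lemma stripe_word_letters:
  assumes cross: "cross_supported n s t j0 i0 \<sigma> cs rs"
  shows "set (stripe_word \<sigma> cs rs i0) \<subseteq> {..<s}"
proof -
  have \<sigma>: "\<sigma> permutes {1..n}" and cs: "is_divider_seq n t cs" "i0 < t" and rs: "is_divider_seq n s rs"
    using cross by (simp_all add: cross_supported_def)
  have "stripe rs (\<sigma> x) < s" if "x \<in> {cs ! i0<..cs ! (i0 + 1)}" for x
    using that stripe_bounds(1)[OF rs, of "\<sigma> x"] permutes_in_image[OF \<sigma>, of x]
    unfolding stripe_set[OF cs] by blast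
  then show ?thesis
    unfolding stripe_word_def set_map set_upt_stripe by blast
qed

text \<open>
  Every point lies in the corner row or in the corner column, and those in both are the corner points;
  so the length condition is inclusion-exclusion for the set of all points.
\<close>
lemma stripe_words_in_word_pairs:
  assumes cross: "cross_supported n s t j0 i0 \<sigma> cs rs"
  shows "(stripe_word (perm_inv \<sigma>) rs cs j0, stripe_word \<sigma> cs rs i0) \<in> word_pairs {..<t} {..<s} i0 j0 n"
proof -
  have \<sigma>: "\<sigma> permutes {1..n}" and cs: "is_divider_seq n t cs" "i0 < t" and rs: "is_divider_seq n s rs" "j0 < s"
    using cross by (simp_all add: cross_supported_def)
  let ?u = "stripe_word (perm_inv \<sigma>) rs cs j0" and ?v = "stripe_word \<sigma> cs rs i0"
  have count: "count_list ?u i0 = count_list ?v j0"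
    unfolding count_inverse_stripe_word[OF cross] count_stripe_word[OF cs] ..
  let ?X = "{x \<in> {1..n}. stripe cs x = i0}" and ?Y = "{x \<in> {1..n}. stripe rs (\<sigma> x) = j0}"
  have "bij_betw \<sigma> ?Y {y \<in> {1..n}. stripe rs y = j0}"
    by (rule permutes_bij_betw_Collect[OF \<sigma>, where P = "\<lambda>x y. stripe rs y = j0"])
  then have "card ?Y = length ?u"
    unfolding length_stripe_word card_stripe[OF rs, symmetric] by (rule bij_betw_same_card)
  moreover have "card ?X = length ?v"
    unfolding length_stripe_word by (rule card_stripe[OF cs])
  moreover have "?X \<union> ?Y = {1..n}"
    using cross by (auto simp: cross_supported_def)
  moreover have "card (?X \<inter> ?Y) = count_list ?u i0"
    unfolding count_inverse_stripe_word[OF cross] by (rule arg_cong[where f = card]) auto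
  moreover have "card ?X + card ?Y = card (?X \<union> ?Y) + card (?X \<inter> ?Y)"
    by (rule card_Un_Int) auto
  ultimately have "length ?u + length ?v = n + count_list ?u i0"
    by simp
  then show ?thesis
    using count stripe_word_letters[OF cross] stripe_word_letters[OF cross_supported_inv[OF cross]]
    by (simp add: word_pairs_def)
qed

lemma dividers_from_words:
  assumes "cross_supported n s t j0 i0 \<sigma> cs rs" "cross_supported n s t j0 i0 \<sigma>' cs' rs'"
    and "stripe_word (perm_inv \<sigma>) rs cs j0 = stripe_word (perm_inv \<sigma>') rs' cs' j0"
    and "stripe_word \<sigma> cs rs i0 = stripe_word \<sigma>' cs' rs' i0"
  shows "cs = cs'"
  by (rule divider_seq_eqI[of n t _ n])
    (use assms stripe_width_from_words[OF assms(1)] stripe_width_from_words[OF assms(2)]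
      in \<open>simp_all add: cross_supported_def\<close>)

lemma stripes_from_word:
  assumes cross: "cross_supported n s t j0 i0 \<sigma> cs rs" "cross_supported n s t j0 i0 \<sigma>' cs rs"
    and word: "stripe_word \<sigma> cs rs i0 = stripe_word \<sigma>' cs rs i0" and x: "x \<in> {1..n}"
  shows "stripe rs (\<sigma> x) = stripe rs (\<sigma>' x)"
proof (cases "stripe cs x = i0")
  case True
  have cs: "is_divider_seq n t cs" "i0 < t" using cross by (simp_all add: cross_supported_def)
  have "x \<in> set [cs ! i0 + 1..<cs ! (i0 + 1) + 1]"
    unfolding set_upt_stripe stripe_set[OF cs] using True x by simp
  then show ?thesis using word unfolding stripe_word_def map_eq_conv by blast
next
  case False
  then have "stripe rs (\<sigma> x) = j0" "stripe rs (\<sigma>' x) = j0"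
    using cross x unfolding cross_supported_def by blast+
  then show ?thesis by simp
qed

section \<open>Griddings and pairs of words\<close>

lemma gridding_cell_indices:
  assumes "is_gridding n M \<sigma> (cs, rs)" "\<sigma> permutes {1..n}" "j < dim_row M" "i < dim_col M"
  shows "cell_indices \<sigma> cs rs (j, i) = {x \<in> {1..n}. stripe cs x = i \<and> stripe rs (\<sigma> x) = j}"
proof -
  have cs: "is_divider_seq n (dim_col M) cs" and rs: "is_divider_seq n (dim_row M) rs"
    using assms(1) by (simp_all add: is_gridding_def)
  show ?thesis
    unfolding cell_indices_def prod.case stripe_set[OF cs assms(4)] stripe_set[OF rs assms(3)]
    using permutes_in_image[OF assms(2)] by blast
qed

lemma gridding_cross_supported:
  assumes M: "cross_shaped M (j0, i0)"
    and grid: "is_gridding n M \<sigma> (cs, rs)" and \<sigma>: "\<sigma> permutes {1..n}"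
  shows "cross_supported n (dim_row M) (dim_col M) j0 i0 \<sigma> cs rs"
proof -
  have cs: "is_divider_seq n (dim_col M) cs" and rs: "is_divider_seq n (dim_row M) rs"
    using grid by (simp_all add: is_gridding_def)
  have "stripe cs x = i0 \<or> stripe rs (\<sigma> x) = j0" if x: "x \<in> {1..n}" for x
  proof (rule ccontr)
    assume off: "\<not> (stripe cs x = i0 \<or> stripe rs (\<sigma> x) = j0)"
    have i: "stripe cs x < dim_col M" using stripe_bounds(1)[OF cs x] .
    have j: "stripe rs (\<sigma> x) < dim_row M"
      using stripe_bounds(1)[OF rs] permutes_in_image[OF \<sigma>] x by blast
    have "M $$ (stripe rs (\<sigma> x), stripe cs x) = Blank"
      using M off i j by (auto simp: cross_shaped_def nonblank_def)
    moreover have "conforms (M $$ (stripe rs (\<sigma> x), stripe cs x)) \<sigma>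
        (cell_indices \<sigma> cs rs (stripe rs (\<sigma> x), stripe cs x))"
      using grid i j by (simp add: is_gridding_def)
    ultimately have "cell_indices \<sigma> cs rs (stripe rs (\<sigma> x), stripe cs x) = {}"
      by simp
    then show False
      using gridding_cell_indices[OF grid \<sigma> j i] x by auto
  qed
  then show ?thesis
    using M cs rs \<sigma> by (simp add: cross_supported_def cross_shaped_def)
qed

text \<open>
  The words determine the dividers, hence the cell of each point both from its index and from its
  value. This fixes the set of indices and the set of values of each cell, and monotonicity does the
  rest.
\<close>
lemma gridding_determined_by_words:
  assumes M: "cross_shaped M (j0, i0)"
    and grid: "is_gridding n M \<sigma> (cs, rs)" "\<sigma> permutes {1..n}"
    and grid': "is_gridding n M \<sigma>' (cs', rs')" "\<sigma>' permutes {1..n}"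
    and row_word: "stripe_word (perm_inv \<sigma>) rs cs j0 = stripe_word (perm_inv \<sigma>') rs' cs' j0"
    and col_word: "stripe_word \<sigma> cs rs i0 = stripe_word \<sigma>' cs' rs' i0"
  shows "\<sigma> = \<sigma>' \<and> cs = cs' \<and> rs = rs'"
proof -
  note cross = gridding_cross_supported[OF M grid] and cross' = gridding_cross_supported[OF M grid']
  have cs: "cs = cs'"
    by (rule dividers_from_words[OF cross cross' row_word col_word])
  have rs: "rs = rs'"
    by (rule dividers_from_words[OF cross_supported_inv[OF cross] cross_supported_inv[OF cross']])
      (use row_word col_word grid(2) grid'(2) in \<open>simp_all add: permutes_inv_inv\<close>)
  note cross' = cross'[folded cs rs] and grid' = grid'[folded cs rs]
  have rows: "stripe rs (\<sigma> x) = stripe rs (\<sigma>' x)" if "x \<in> {1..n}" for x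
    using stripes_from_word[OF cross cross'] col_word that cs rs by simp
  have cols: "stripe cs (perm_inv \<sigma> y) = stripe cs (perm_inv \<sigma>' y)" if "y \<in> {1..n}" for y
    using stripes_from_word[OF cross_supported_inv[OF cross] cross_supported_inv[OF cross']]
      row_word that cs rs by simp
  have "\<sigma> x = \<sigma>' x" for x
  proof (cases "x \<in> {1..n}")
    case False
    then show ?thesis using grid(2) grid'(2) by (metis permutes_not_in)
  next
    case True
    define i j where "i = stripe cs x" and "j = stripe rs (\<sigma> x)"
    let ?X = "{x \<in> {1..n}. stripe cs x = i \<and> stripe rs (\<sigma> x) = j}"
    have i: "i < dim_col M"
      using grid(1) True stripe_bounds(1) by (auto simp: is_gridding_def i_def)
    have j: "j < dim_row M"
      using grid True stripe_bounds(1) permutes_in_image[OF grid(2), of x]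
      by (auto simp: is_gridding_def j_def)
    have X': "?X = {x \<in> {1..n}. stripe cs x = i \<and> stripe rs (\<sigma>' x) = j}"
      using rows by auto
    have conf: "conforms (M $$ (j, i)) \<sigma> ?X"
      unfolding gridding_cell_indices[OF grid j i, symmetric]
      using grid(1) i j by (simp add: is_gridding_def)
    have conf': "conforms (M $$ (j, i)) \<sigma>' ?X"
      unfolding X' gridding_cell_indices[OF grid' j i, symmetric]
      using grid'(1) i j by (simp add: is_gridding_def)
    have image: "\<tau> ` {x \<in> {1..n}. stripe cs x = i \<and> stripe rs (\<tau> x) = j} =
        {y \<in> {1..n}. stripe rs y = j \<and> stripe cs (perm_inv \<tau> y) = i}" if \<tau>: "\<tau> permutes {1..n}" for \<tau>
      using bij_betw_imp_surj_on[OF permutes_bij_betw_Collect[OF \<tau>,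
            where P = "\<lambda>x y. stripe cs x = i \<and> stripe rs y = j"]]
      by (simp only: conj_commute)
    have "\<sigma> ` ?X = {y \<in> {1..n}. stripe rs y = j \<and> stripe cs (perm_inv \<sigma> y) = i}"
      by (rule image[OF grid(2)])
    also have "\<dots> = {y \<in> {1..n}. stripe rs y = j \<and> stripe cs (perm_inv \<sigma>' y) = i}"
      using cols by auto
    also have "\<dots> = \<sigma>' ` ?X"
      unfolding X' by (rule image[OF grid'(2), symmetric])
    finally show ?thesis
      by (rule conforming_unique[OF conf conf']) (use True in \<open>simp add: i_def j_def\<close>)
  qed
  then show ?thesis using cs rs by blast
qed

text \<open>
  Reads off, from a prescribed word \<open>w\<close> of stripe \<open>d\<close>, the crossing stripe in which \<open>x\<close> should lie.
  Outside stripe \<open>d\<close> a cross leaves no choice: it has to be \<open>e\<close>. As stripe \<open>d\<close> starts at the index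
  \<open>ds ! d + 1\<close>, that index gets the letter at position 0.
\<close>
definition word_label :: "nat list \<Rightarrow> nat \<Rightarrow> 'a list \<Rightarrow> 'a \<Rightarrow> nat \<Rightarrow> 'a" where
  "word_label ds d w e x = (if stripe ds x = d then w ! (x - ds ! d - 1) else e)"

lemma map_word_label:
  assumes ds: "is_divider_seq n t ds" "d < t" and w: "length w = ds ! (d + 1) - ds ! d"
  shows "map (word_label ds d w e) [ds ! d + 1..<ds ! (d + 1) + 1] = w"
proof (rule nth_equalityI)
  show len: "length (map (word_label ds d w e) [ds ! d + 1..<ds ! (d + 1) + 1]) = length w"
    using w by (simp del: upt_Suc)
  show "map (word_label ds d w e) [ds ! d + 1..<ds ! (d + 1) + 1] ! k = w ! k"
    if "k < length (map (word_label ds d w e) [ds ! d + 1..<ds ! (d + 1) + 1])" for k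
  proof -
    have k: "k < ds ! (d + 1) - ds ! d" using that by (simp del: upt_Suc)
    have "stripe ds (ds ! d + 1 + k) = d"
      by (rule stripe_eq[OF ds]) (use k in auto)
    then show ?thesis using k by (simp add: word_label_def del: upt_Suc)
  qed
qed

lemma card_word_label:
  assumes ds: "is_divider_seq n t ds" "d < t" and w: "length w = ds ! (d + 1) - ds ! d" and i: "i < t"
  shows "card {x \<in> {1..n}. stripe ds x = i \<and> word_label ds d w e x = j} =
    (if i = d then count_list w j else if j = e then ds ! (i + 1) - ds ! i else 0)"
proof (cases "i = d")
  case True
  have "count_list w j = card {x \<in> {ds ! d<..ds ! (d + 1)}. word_label ds d w e x = j}"
    by (subst (1) map_word_label[OF ds w, symmetric, where e = e], subst count_list_map_distinct)
      (simp_all only: distinct_upt set_upt_stripe)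
  also have "{x \<in> {ds ! d<..ds ! (d + 1)}. word_label ds d w e x = j} =
      {x \<in> {1..n}. stripe ds x = i \<and> word_label ds d w e x = j}"
    unfolding stripe_set[OF ds] using True by auto
  finally show ?thesis using True by simp
next
  case False
  then have "{x \<in> {1..n}. stripe ds x = i \<and> word_label ds d w e x = j} =
      (if j = e then {x \<in> {1..n}. stripe ds x = i} else {})"
    by (auto simp: word_label_def)
  then show ?thesis using False card_stripe[OF ds(1) i] by simp
qed

lemma word_label_less:
  assumes ds: "is_divider_seq n t ds" "d < t" and w: "length w = ds ! (d + 1) - ds ! d"
    and letters: "set w \<subseteq> {..<s}" and e: "e < s" and x: "x \<in> {1..n}"
  shows "word_label ds d w e x < s"
proof (cases "stripe ds x = d")
  case True
  then have "x - ds ! d - 1 < length w"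
    using stripe_bounds[OF ds(1) x] w by auto
  then show ?thesis using letters nth_mem True by (fastforce simp: word_label_def)
qed (use e in \<open>simp add: word_label_def\<close>)

text \<open>
  The widths of the columns read off from the words, as in \<open>stripe_width_from_words\<close>, add up to \<open>n\<close>,
  because the corner points, counted twice in the total length, are counted once here.
\<close>
lemma sum_word_widths:
  fixes u :: "nat list"
  assumes u: "set u \<subseteq> {..<t}" and "i0 < t" and len: "length u + l = n + count_list u i0"
  shows "(\<Sum>i<t. if i = i0 then l else count_list u i) = n"
proof -
  have "(\<Sum>i<t. if i = i0 then l else count_list u i) = l + (\<Sum>i\<in>{..<t} - {i0}. count_list u i)"
    using \<open>i0 < t\<close> by (subst sum.remove[of _ i0]) auto
  moreover have "length u = count_list u i0 + (\<Sum>i\<in>{..<t} - {i0}. count_list u i)"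
    using \<open>i0 < t\<close> sum_count_set[OF u finite_lessThan] by (subst (asm) sum.remove[of _ i0]) auto
  ultimately show ?thesis using len by simp
qed

text \<open>
  The words give the dividers and then, through \<open>word_label\<close>, the intended cell of every index and of
  every value. A cell of the corner column has as many indices as its row has letters in \<open>v\<close>, and a cell
  of the corner row has as many values as its column has letters in \<open>u\<close>. The choice of the widths makes
  the numbers of indices and values agree in all cells other than the corner, where they agree by the
  condition on the pair of words.
\<close>
lemma gridding_with_words_exists:
  assumes M: "cross_shaped M (j0, i0)"
    and uv: "(u, v) \<in> word_pairs {..<dim_col M} {..<dim_row M} i0 j0 n"
  obtains \<sigma> cs rs where "\<sigma> permutes {1..n}" "is_gridding n M \<sigma> (cs, rs)"
    "stripe_word (perm_inv \<sigma>) rs cs j0 = u" "stripe_word \<sigma> cs rs i0 = v"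
proof -
  let ?s = "dim_row M" and ?t = "dim_col M"
  have ji: "j0 < ?s" "i0 < ?t" using M by (simp_all add: cross_shaped_def)
  have letters: "set u \<subseteq> {..<?t}" "set v \<subseteq> {..<?s}"
    and count: "count_list u i0 = count_list v j0"
    and len: "length u + length v = n + count_list u i0"
    using uv by (auto simp: word_pairs_def)
  obtain cs where cs: "is_divider_seq n ?t cs"
    and widths: "\<And>i. i < ?t \<Longrightarrow> cs ! (i + 1) = cs ! i + (if i = i0 then length v else count_list u i)"
    using divider_seq_with_widths[OF sum_word_widths[OF letters(1) ji(2) len]] by blast
  have len': "length v + length u = n + count_list v j0" using len count by simp
  obtain rs where rs: "is_divider_seq n ?s rs"
    and heights: "\<And>j. j < ?s \<Longrightarrow> rs ! (j + 1) = rs ! j + (if j = j0 then length u else count_list v j)"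
    using divider_seq_with_widths[OF sum_word_widths[OF letters(2) ji(1) len']] by blast
  have len_v: "length v = cs ! (i0 + 1) - cs ! i0" using widths[OF ji(2)] by simp
  have len_u: "length u = rs ! (j0 + 1) - rs ! j0" using heights[OF ji(1)] by simp
  let ?R = "word_label cs i0 v j0" and ?C = "word_label rs j0 u i0"
  let ?I = "{..<?s} \<times> {..<?t}"
  have card_source: "card {x \<in> {1..n}. (?R x, stripe cs x) = (j, i)} =
      (if i = i0 then count_list v j else if j = j0 then count_list u i else 0)" if "i < ?t" for j i
    using card_word_label[OF cs ji(2) len_v that, of j0 j] widths[OF that]
    by (simp add: conj_commute)
  have card_target: "card {y \<in> {1..n}. (stripe rs y, ?C y) = (j, i)} =
      (if j = j0 then count_list u i else if i = i0 then count_list v j else 0)" if "j < ?s" for j i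
    using card_word_label[OF rs ji(1) len_u that, of i0 i] heights[OF that] by simp
  have card_eq: "card {x \<in> {1..n}. (?R x, stripe cs x) = k} = card {y \<in> {1..n}. (stripe rs y, ?C y) = k}"
    if k: "k \<in> ?I" for k
  proof -
    obtain j i where ji_eq: "k = (j, i)" "j < ?s" "i < ?t" using k by auto
    show ?thesis
      unfolding ji_eq(1) card_source[OF ji_eq(3)] card_target[OF ji_eq(2)] using count by simp
  qed
  have blank: "{x \<in> {1..n}. (?R x, stripe cs x) = k} = {}" if k: "k \<in> ?I" and "M $$ k = Blank" for k
  proof -
    obtain j i where ji_eq: "k = (j, i)" "j < ?s" "i < ?t" using k by auto
    have "j \<noteq> j0 \<and> i \<noteq> i0" using M \<open>M $$ k = Blank\<close> ji_eq by (auto simp: cross_shaped_def nonblank_def)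
    then have "card {x \<in> {1..n}. (?R x, stripe cs x) = k} = 0"
      unfolding ji_eq(1) card_source[OF ji_eq(3)] by simp
    then show ?thesis by (subst (asm) card_0_eq) auto
  qed
  have range: "(\<lambda>x. (?R x, stripe cs x)) ` {1..n} \<subseteq> ?I"
  proof (rule image_subsetI)
    fix x assume x: "x \<in> {1..n}"
    show "(?R x, stripe cs x) \<in> ?I"
      using word_label_less[OF cs ji(2) len_v letters(2) ji(1) x] stripe_bounds(1)[OF cs x] by simp
  qed
  have "\<exists>\<sigma>. \<sigma> permutes {1..n} \<and>
      (\<forall>x\<in>{1..n}. (stripe rs (\<sigma> x), ?C (\<sigma> x)) = (?R x, stripe cs x)) \<and>
      (\<forall>k\<in>?I. conforms (M $$ k) \<sigma> {x \<in> {1..n}. (?R x, stripe cs x) = k})"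
    by (rule piecewise_conforming_permutation_exists[of "{1..n}" ?I "\<lambda>x. (?R x, stripe cs x)"
        "\<lambda>y. (stripe rs y, ?C y)" "\<lambda>k. M $$ k"])
      (fact finite_atLeastAtMost card_eq blank range)+
  then obtain \<sigma> where \<sigma>: "\<sigma> permutes {1..n}"
    and labels': "\<forall>x\<in>{1..n}. (stripe rs (\<sigma> x), ?C (\<sigma> x)) = (?R x, stripe cs x)"
    and conf': "\<forall>k\<in>?I. conforms (M $$ k) \<sigma> {x \<in> {1..n}. (?R x, stripe cs x) = k}"
    by (elim exE conjE) (rule that)
  note labels = bspec[OF labels'] and conf = bspec[OF conf']
  have "is_gridding n M \<sigma> (cs, rs)"
    unfolding is_gridding_def prod.case
  proof (intro conjI allI impI cs rs)
    fix j i assume j: "j < ?s" and i: "i < ?t"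
    have "\<sigma> x \<in> {1..n} \<and> (stripe rs (\<sigma> x) = j \<longleftrightarrow> ?R x = j)" if "x \<in> {1..n}" for x
      using labels[OF that] permutes_in_image[OF \<sigma>, of x] that by simp
    then have "cell_indices \<sigma> cs rs (j, i) = {x \<in> {1..n}. (?R x, stripe cs x) = (j, i)}"
      unfolding cell_indices_def prod.case stripe_set[OF cs i] stripe_set[OF rs j] prod.inject by blast
    then show "conforms (M $$ (j, i)) \<sigma> (cell_indices \<sigma> cs rs (j, i))"
      using conf[of "(j, i)"] i j by simp
  qed
  moreover have "stripe_word \<sigma> cs rs i0 = v"
  proof -
    have "stripe rs (\<sigma> x) = ?R x" if "x \<in> set [cs ! i0 + 1..<cs ! (i0 + 1) + 1]" for x
      using that labels[of x] unfolding set_upt_stripe stripe_set[OF cs ji(2)] by simp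
    then have "stripe_word \<sigma> cs rs i0 = map ?R [cs ! i0 + 1..<cs ! (i0 + 1) + 1]"
      unfolding stripe_word_def by (intro map_cong refl)
    then show ?thesis using map_word_label[OF cs ji(2) len_v] by simp
  qed
  moreover have "stripe_word (perm_inv \<sigma>) rs cs j0 = u"
  proof -
    have "stripe cs (perm_inv \<sigma> y) = ?C y" if "y \<in> set [rs ! j0 + 1..<rs ! (j0 + 1) + 1]" for y
    proof -
      have "perm_inv \<sigma> y \<in> {1..n}"
        using that permutes_in_image[OF permutes_inv[OF \<sigma>], of y]
        unfolding set_upt_stripe stripe_set[OF rs ji(1)] by simp
      then show ?thesis using labels[of "perm_inv \<sigma> y"] permutes_inverses(1)[OF \<sigma>, of y] by simp
    qed
    then have "stripe_word (perm_inv \<sigma>) rs cs j0 = map ?C [rs ! j0 + 1..<rs ! (j0 + 1) + 1]"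
      unfolding stripe_word_def by (intro map_cong refl)
    then show ?thesis using map_word_label[OF rs ji(1) len_u] by simp
  qed
  ultimately show ?thesis by (intro that[OF \<sigma>])
qed

text \<open>
  Assigning to a gridding its row word and its column word through the corner is a bijection.
\<close>
lemma card_gridded_perms_cross_shaped:
  assumes M: "cross_shaped M (j0, i0)"
  shows "card (gridded_perms n M) = card (word_pairs {..<dim_col M} {..<dim_row M} i0 j0 n)"
proof -
  let ?words = "\<lambda>(\<sigma>, cs, rs). (stripe_word (perm_inv \<sigma>) rs cs j0, stripe_word \<sigma> cs rs i0)"
  have "inj_on ?words (gridded_perms n M)"
    unfolding inj_on_def gridded_perms_def
    using gridding_determined_by_words[OF M] by clarsimp
  moreover have "?words ` gridded_perms n M = word_pairs {..<dim_col M} {..<dim_row M} i0 j0 n"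
  proof
    show "?words ` gridded_perms n M \<subseteq> word_pairs {..<dim_col M} {..<dim_row M} i0 j0 n"
      using stripe_words_in_word_pairs[OF gridding_cross_supported[OF M]]
      by (auto simp: gridded_perms_def)
    show "word_pairs {..<dim_col M} {..<dim_row M} i0 j0 n \<subseteq> ?words ` gridded_perms n M"
    proof (rule subrelI)
      fix u v assume "(u, v) \<in> word_pairs {..<dim_col M} {..<dim_row M} i0 j0 n"
      then obtain \<sigma> cs rs where "\<sigma> permutes {1..n}" "is_gridding n M \<sigma> (cs, rs)"
        "stripe_word (perm_inv \<sigma>) rs cs j0 = u" "stripe_word \<sigma> cs rs i0 = v"
        by (rule gridding_with_words_exists[OF M])
      then show "(u, v) \<in> ?words ` gridded_perms n M"
        by (intro image_eqI[of _ _ "(\<sigma>, cs, rs)"]) (simp_all add: gridded_perms_def)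
    qed
  qed
  ultimately have "bij_betw ?words (gridded_perms n M) (word_pairs {..<dim_col M} {..<dim_row M} i0 j0 n)"
    by (rule bij_betw_imageI)
  then show ?thesis by (rule bij_betw_same_card)
qed

section \<open>The asymptotics of a second-order linear recurrence\<close>

lemma linear_recurrence_solution:
  fixes a :: "nat \<Rightarrow> real"
  assumes "g \<noteq> h" and "a 0 = 1" "a 1 = g + h"
    and rec: "\<And>n. a (Suc (Suc n)) = (g + h) * a (Suc n) - g * h * a n"
  shows "a n = (g ^ (n + 1) - h ^ (n + 1)) / (g - h)"
proof -
  have "a n * (g - h) = g ^ (n + 1) - h ^ (n + 1)"
  proof (induction n rule: induct_nat_012)
    case 0
    then show ?case using assms(2) by simp
  next
    case 1
    then show ?case using assms(3) by (simp add: algebra_simps power2_eq_square)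
  next
    case (ge2 n)
    have "a (Suc (Suc n)) * (g - h) = (g + h) * (a (Suc n) * (g - h)) - g * h * (a n * (g - h))"
      unfolding rec by (simp add: algebra_simps)
    also have "\<dots> = g ^ (Suc (Suc n) + 1) - h ^ (Suc (Suc n) + 1)"
      unfolding ge2 by (simp add: algebra_simps)
    finally show ?case .
  qed
  then show ?thesis using assms(1) by (simp add: field_simps)
qed

lemma dominant_root_asymp_equiv:
  fixes g h :: real
  assumes "0 \<le> h" "h < g"
  shows "(\<lambda>n. (g ^ (n + 1) - h ^ (n + 1)) / (g - h)) \<sim>[sequentially] (\<lambda>n. g / (g - h) * g ^ n)"
proof (rule asymp_equivI')
  have "(\<lambda>n. (h / g) ^ n) \<longlonglongrightarrow> 0"
    by (rule LIMSEQ_realpow_zero) (use assms in auto)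
  then have "(\<lambda>n. 1 - (h / g) ^ (n + 1)) \<longlonglongrightarrow> 1 - 0"
    by (intro tendsto_diff tendsto_const LIMSEQ_ignore_initial_segment)
  moreover have "(g ^ (n + 1) - h ^ (n + 1)) / (g - h) / (g / (g - h) * g ^ n) = 1 - (h / g) ^ (n + 1)" for n
    using assms by (simp add: field_simps power_divide)
  ultimately show "(\<lambda>n. (g ^ (n + 1) - h ^ (n + 1)) / (g - h) / (g / (g - h) * g ^ n)) \<longlonglongrightarrow> 1"
    by simp
qed

section \<open>The number of gridded permutations\<close>

theorem proposition4p3:
  fixes M :: gridding_matrix and r c :: nat
  defines "q \<equiv> sqrt ((real r + real c + 1)\<^sup>2 - 4 * real c * real r)"
  defines "\<theta> \<equiv> (real r + real c + q + 1) / (2 * q)"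
  defines "g \<equiv> (real r + real c + q + 1) / 2"
  assumes "r \<ge> 1" and "c \<ge> 1"
    and "M \<in> carrier_mat (r + 1) (c + 1)"
    and "connected_gridding_matrix M"
    and "\<exists>!C. is_corner M C"
  shows "(\<lambda>n. real (card (gridded_perms n M))) \<sim>[sequentially] (\<lambda>n. \<theta> * g ^ n)"
proof -
  define h where "h = (real r + real c + 1 - q) / 2"
  define a where "a n = real (card (gridded_perms n M))" for n
  obtain C where "is_corner M C" "\<And>D. is_corner M D \<Longrightarrow> D = C"
    using assms(8) by blast
  then have cross: "cross_shaped M C"
    by (rule one_corner_cross_shaped[OF assms(7)])
  obtain j0 i0 where C: "C = (j0, i0)" by (cases C)
  have dims: "dim_row M = r + 1" "dim_col M = c + 1" using assms(6) by auto
  have ji: "i0 \<in> {..<c + 1}" "j0 \<in> {..<r + 1}"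
    using cross by (simp_all add: C cross_shaped_def dims)
  have a_eq: "a n = real (card (word_pairs {..<c + 1} {..<r + 1} i0 j0 n))" for n
    unfolding a_def by (simp only: card_gridded_perms_cross_shaped[OF cross[unfolded C]] dims)

  \<comment> \<open>This form of the discriminant shows that the roots are real and distinct.\<close>
  have disc: "(real r + real c + 1)\<^sup>2 - 4 * real c * real r = (real r - real c)\<^sup>2 + 2 * (real r + real c) + 1"
    by (simp add: power2_eq_square algebra_simps)
  have disc_pos: "(real r + real c + 1)\<^sup>2 - 4 * real c * real r > 0"
    unfolding disc by (intro add_nonneg_pos add_nonneg_nonneg) auto
  then have "q > 0" and q2: "q\<^sup>2 = (real r + real c + 1)\<^sup>2 - 4 * real c * real r"
    by (simp_all add: q_def)
  have "q \<le> real r + real c + 1"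
    by (rule power2_le_imp_le) (simp_all add: q2)
  then have h: "0 \<le> h" "h < g" using \<open>q > 0\<close> by (simp_all add: h_def g_def)
  have sum_roots: "g + h = real r + real c + 1" by (simp add: g_def h_def field_simps)
  have prod_roots: "g * h = real c * real r"
    using q2 by (simp add: g_def h_def field_simps power2_eq_square)
  have diff_roots: "g - h = q" by (simp add: g_def h_def field_simps)

  have "a (Suc (Suc n)) = (g + h) * a (Suc n) - g * h * a n" for n
  proof -
    have "real (card (word_pairs {..<c + 1} {..<r + 1} i0 j0 (Suc (Suc n))) +
          c * r * card (word_pairs {..<c + 1} {..<r + 1} i0 j0 n)) =
        real ((c + r + 1) * card (word_pairs {..<c + 1} {..<r + 1} i0 j0 (Suc n)))"
      using card_word_pairs_Suc_Suc[OF _ _ ji, of n] by (intro arg_cong[where f = real]) simp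
    then show ?thesis
      unfolding sum_roots prod_roots a_eq of_nat_add of_nat_mult by (simp add: algebra_simps)
  qed
  moreover have "a 0 = 1" by (simp add: a_eq word_pairs_0)
  moreover have "a 1 = g + h"
    unfolding sum_roots a_eq card_word_pairs_1[OF finite_lessThan finite_lessThan ji] by simp
  ultimately have closed: "a n = (g ^ (n + 1) - h ^ (n + 1)) / (g - h)" for n
    using linear_recurrence_solution[of g h a] h by simp
  have "\<theta> = g / (g - h)" unfolding diff_roots by (simp add: \<theta>_def g_def)
  then have "a \<sim>[sequentially] (\<lambda>n. \<theta> * g ^ n)"
    using dominant_root_asymp_equiv[OF h] closed by presburger
  then show ?thesis by (simp add: a_def[abs_def])
qed

end
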